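(* Let $\mathbb{F}$ be a field, let $V$ be an infinite-dimensional vector space over $\mathbb{F}$, and let $p_1,p_2,p_3$ be split non-derogatory polynomials of $\mathbb{F}[t]$ with degree $2$. Let $u$ be an automorphism of $V$. Assume that $u$ has a dominant eigenvalue $\lambda$ that is acceptable for $(p_1,p_2,p_3)$ and such that $u-\lambda\,\mathrm{id}_V$ does not have finite rank. Then $u$ is a $(p_1,p_2,p_3)$-product in $\mathrm{End}(V)$.
   Context: A polynomial $p\in\mathbb{F}[t]$ is called non-derogatory if $p(0)\neq 0$. For non-derogatory polynomials $p_1,\dots,p_n$, an element $x$ of a (unital associative) $\mathbb{F}$-algebra $\mathcal{A}$ is called a $(p_1,\dots,p_n)$-product if $x=a_1\cdots a_n$ for some $a_1,\dots,a_n\in\mathcal{A}$ with $p_i(a_i)=0$ for all $i$. For $u\in\mathrm{End}(V)$, a scalar $\lambda\in\mathbb{F}$ is called a dominant eigenvalue of $u$ if $\mathrm{rk}(u-\lambda\,\mathrm{id}_V)<\dim V$ (inequality of cardinals). The norm $N(p)$ of a monic polynomial $p$ of degree $n$ is $(-1)^np(0)$, and the norm of a nonzero polynomial $p$ with leading coefficient $\alpha$ is that of $\alpha^{-1}p$. A scalar $\lambda\in\mathbb{F}$ is called acceptable for $(p_1,p_2,p_3)$ if $\lambda$ is a $(p_1,p_2,p_3)$-product in the algebra $\mathbb{F}$ or $\lambda^2=N(p_1)N(p_2)N(p_3)$. *)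

theory Defs
  imports "HOL-Computational_Algebra.Polynomial" "HOL-Library.Multiset"
begin

unbundle cardinal_syntax

definition splits :: "'f::field poly \<Rightarrow> bool" where
  "splits p \<longleftrightarrow> (\<exists>A. p = smult (lead_coeff p) (\<Prod>c\<in>#A. [:- c, 1:]))"

definition nonderogatory :: "'f::field poly \<Rightarrow> bool" where
  "nonderogatory p \<longleftrightarrow> poly p 0 \<noteq> 0"

definition monic_norm :: "'f::field poly \<Rightarrow> 'f" where
  "monic_norm p = (- 1) ^ degree p * poly p 0"

definition poly_norm :: "'f::field poly \<Rightarrow> 'f" where
  "poly_norm p = monic_norm (smult (inverse (lead_coeff p)) p)"

text \<open>The notion of a \<open>(p\<^sub>1, \<dots>, p\<^sub>n)\<close>-product in an algebra is used for two algebras: the ground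
  field, treated here, and the algebra of endomorphisms of a vector space, treated below.\<close>

definition scalar_product_of :: "'f::field poly list \<Rightarrow> 'f \<Rightarrow> bool" where
  "scalar_product_of ps x \<longleftrightarrow> (\<exists>as. list_all2 (\<lambda>p a. poly p a = 0) ps as \<and> x = prod_list as)"

definition acceptable :: "'f::field poly \<Rightarrow> 'f poly \<Rightarrow> 'f poly \<Rightarrow> 'f \<Rightarrow> bool" where
  "acceptable p1 p2 p3 c \<longleftrightarrow>
     scalar_product_of [p1, p2, p3] c \<or> c\<^sup>2 = poly_norm p1 * poly_norm p2 * poly_norm p3"

text \<open>The library function \<open>dim\<close> is a natural number (zero in infinite dimension); the dimension
  needed here is a cardinal, represented as a cardinal order as in the library.\<close>

definition cdim :: "('f::field \<Rightarrow> 'v::ab_group_add \<Rightarrow> 'v) \<Rightarrow> 'v set \<Rightarrow> 'v rel" where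
  "cdim scale S = |SOME B. \<not> module.dependent scale B \<and> module.span scale B = module.span scale S|"

lemma cdim_unique:
  assumes "vector_space scale"
    and B: "\<not> module.dependent scale B" "module.span scale B = module.span scale S"
  shows "|B| =o cdim scale S"
proof -
  interpret vs: vector_space scale by fact
  define C where "C = (SOME B. vs.independent B \<and> vs.span B = vs.span S)"
  have "vs.independent C \<and> vs.span C = vs.span S"
    unfolding C_def by (rule someI[where x = B]) (use B in blast)
  with B obtain f where "bij_betw f B C"
    using vs.bij_if_span_eq_span_bases by metis
  then show ?thesis
    unfolding cdim_def C_def[symmetric] using card_of_ordIsoI by blast
qed

lemma cdim_basis_exists:
  assumes "vector_space scale"
  obtains B where "\<not> module.dependent scale B" "module.span scale B = module.span scale S"
    "|B| =o cdim scale S"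
proof -
  interpret vs: vector_space scale by fact
  obtain B where B: "B \<subseteq> S" "vs.independent B" "S \<subseteq> vs.span B"
    using vs.maximal_independent_subset by blast
  then have "vs.span B = vs.span S"
    by (simp add: vs.span_mono vs.span_minimal subset_antisym)
  with B that cdim_unique[OF assms] show thesis by blast
qed

definition endo :: "('f::field \<Rightarrow> 'v::ab_group_add \<Rightarrow> 'v) \<Rightarrow> ('v \<Rightarrow> 'v) \<Rightarrow> bool" where
  "endo scale u \<longleftrightarrow> Vector_Spaces.linear scale scale u"

definition automorphism :: "('f::field \<Rightarrow> 'v::ab_group_add \<Rightarrow> 'v) \<Rightarrow> ('v \<Rightarrow> 'v) \<Rightarrow> bool" where
  "automorphism scale u \<longleftrightarrow> endo scale u \<and> bij u"

definition rk :: "('f::field \<Rightarrow> 'v::ab_group_add \<Rightarrow> 'v) \<Rightarrow> ('v \<Rightarrow> 'v) \<Rightarrow> 'v rel" where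
  "rk scale u = cdim scale (range u)"

definition dominant_eigenvalue ::
    "('f::field \<Rightarrow> 'v::ab_group_add \<Rightarrow> 'v) \<Rightarrow> ('v \<Rightarrow> 'v) \<Rightarrow> 'f \<Rightarrow> bool" where
  "dominant_eigenvalue scale u c \<longleftrightarrow> rk scale (\<lambda>x. u x - scale c x) <o cdim scale UNIV"

definition endo_poly ::
    "('f::field \<Rightarrow> 'v::ab_group_add \<Rightarrow> 'v) \<Rightarrow> 'f poly \<Rightarrow> ('v \<Rightarrow> 'v) \<Rightarrow> 'v \<Rightarrow> 'v" where
  "endo_poly scale p a = (\<lambda>x. \<Sum>i\<le>degree p. scale (coeff p i) ((a ^^ i) x))"

definition endo_product_of ::
    "('f::field \<Rightarrow> 'v::ab_group_add \<Rightarrow> 'v) \<Rightarrow> 'f poly list \<Rightarrow> ('v \<Rightarrow> 'v) \<Rightarrow> bool" where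
  "endo_product_of scale ps u \<longleftrightarrow>
     (\<exists>as. list_all2 (\<lambda>p a. endo scale a \<and> endo_poly scale p a = (\<lambda>x. 0)) ps as \<and>
       u = foldr (\<circ>) as id)"

end

theory Submission
  imports Defs
begin

text \<open>Put \<open>w = u - c\<close>. Since \<open>w\<close> has infinite rank smaller than the dimension of the space, its kernel is
  large enough to choose a complement of the kernel that meets the image only in \<open>0\<close>. This gives a basis
  consisting of vectors \<open>k \<in> K\<close>, \<open>e k\<close> and \<open>x \<in> F\<close> with \<open>w (e k) = s k\<close> for an injection \<open>s\<close> of
  \<open>K\<close> onto a basis of the image of \<open>w\<close>, and with \<open>w x = 0\<close> on \<open>F\<close>. Take a quadratic operator \<open>g\<close> whose
  inverse sends \<open>k\<close> to \<open>k / a3 + e k\<close> and \<open>e k\<close> to \<open>e k / b3\<close>. If \<open>s\<close> raises a suitable rank fast enough, then away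
  from \<open>F\<close> the operator \<open>v = u \<circ> inv g\<close> turns the space into a free module over the Laurent polynomials, with
  basis \<open>K - s ` K\<close>, whatever the action of \<open>u\<close> on the image of \<open>w\<close> is. The same holds for a product \<open>t\<close> of
  two quadratic operators of the required type that are written down explicitly, so \<open>v\<close> and \<open>t\<close> are
  conjugate. The acceptability of \<open>c\<close> is needed only on \<open>F\<close>, where \<open>u\<close> is the scalar \<open>c\<close>.\<close>

section \<open>Quadratic endomorphisms\<close>

locale endo_algebra = vector_space scale
  for scale :: "'a::field \<Rightarrow> 'b::ab_group_add \<Rightarrow> 'b" (infixr \<open>*s\<close> 75)
begin

section \<open>Linear calculus for endomorphisms and extension from independent sets\<close>

lemma endo_iff:
  "endo scale f \<longleftrightarrow> (\<forall>x y. f (x + y) = f x + f y) \<and> (\<forall>a x. f (a *s x) = a *s f x)"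
  by (simp add: endo_def Vector_Spaces.linear_iff vector_space_axioms)

lemma endo_add: "endo scale f \<Longrightarrow> f (x + y) = f x + f y"
  and endo_scale: "endo scale f \<Longrightarrow> f (a *s x) = a *s f x"
  by (auto simp: endo_iff)

lemma endo_zero: "endo scale f \<Longrightarrow> f 0 = 0"
  using endo_scale[of f 0 0] by simp

lemma endo_diff: "endo scale f \<Longrightarrow> f (x - y) = f x - f y"
  by (metis add_diff_cancel diff_add_cancel endo_add)

lemmas endo_simps = endo_add endo_diff endo_scale endo_zero

lemma endo_comp: "endo scale f \<Longrightarrow> endo scale g \<Longrightarrow> endo scale (\<lambda>x. f (g x))"
  by (simp add: endo_iff)

lemma endo_scalar: "endo scale (scale a)"
  by (simp add: endo_iff scale_right_distrib mult.commute)

lemma endo_span_eq: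
  assumes "endo scale f" "endo scale g" "x \<in> span S" "\<And>b. b \<in> S \<Longrightarrow> f b = g b"
  shows "f x = g x"
  using assms(3)
  by (induction rule: span_induct_alt) (use assms in \<open>auto simp: endo_simps\<close>)

lemma endo_span_mem:
  assumes "endo scale f" "x \<in> span S" "\<And>b. b \<in> S \<Longrightarrow> f b \<in> span T"
  shows "f x \<in> span T"
  using assms(2)
  by (induction rule: span_induct_alt)
    (use assms in \<open>auto simp: endo_simps intro: span_zero span_add span_scale\<close>)

lemma endo_extend:
  assumes "independent B"
  shows "\<exists>f. endo scale f \<and> (\<forall>b\<in>B. f b = h b)"
proof -
  interpret vector_space_pair scale scale by unfold_locales
  show ?thesis
    unfolding endo_def using linear_independent_extend[OF assms] by blast
qed

section \<open>Operators annihilated by \<open>(t - a) * (t - b)\<close>, with \<open>a = b\<close>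
  allowed\<close>

definition quadratic :: "'a \<Rightarrow> 'a \<Rightarrow> ('b \<Rightarrow> 'b) \<Rightarrow> bool" where
  "quadratic a b f \<longleftrightarrow> endo scale f \<and> (\<forall>x. f (f x) = (a + b) *s f x - (a * b) *s x)"

lemma quadratic_on_span:
  assumes f: "endo scale f" and "x \<in> span S"
    and S: "\<And>x. x \<in> S \<Longrightarrow> f (f x) = (a + b) *s f x - (a * b) *s x"
  shows "f (f x) = (a + b) *s f x - (a * b) *s x"
  by (rule endo_span_eq[OF _ _ assms(2)])
    (use f S in \<open>simp_all add: endo_iff scale_right_distrib scale_right_diff_distrib ac_simps\<close>)

lemma quadratic_conjugate:
  assumes "quadratic a b f" and P: "endo scale P" "endo scale P'" "\<And>x. P (P' x) = x"
    "\<And>x. P' (P x) = x"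
  shows "quadratic a b (\<lambda>x. P' (f (P x)))"
  using assms(1) P by (simp add: quadratic_def endo_comp[OF _ endo_comp] endo_simps[OF P(2)])

text \<open>The quadratic relation reads \<open>f ((a + b) - f) = a b\<close>, so the inverse is a
  polynomial in \<open>f\<close>.\<close>

definition quadratic_inv :: "'a \<Rightarrow> 'a \<Rightarrow> ('b \<Rightarrow> 'b) \<Rightarrow> 'b \<Rightarrow> 'b" where
  "quadratic_inv a b f x = inverse (a * b) *s ((a + b) *s x - f x)"

lemma quadratic_inv:
  assumes f: "quadratic a b f" and "a * b \<noteq> 0"
  shows "quadratic_inv a b f (f x) = x" "f (quadratic_inv a b f x) = x"
    "endo scale (quadratic_inv a b f)" "bij f" "bij (quadratic_inv a b f)"
proof -
  have fe: "endo scale f" and ff: "\<And>x. f (f x) = (a + b) *s f x - (a * b) *s x"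
    using f by (auto simp: quadratic_def)
  have ab: "inverse (a * b) * (a * b) = 1"
    using assms(2) by (rule left_inverse)
  show left: "quadratic_inv a b f (f x) = x" for x
    using ab by (simp add: quadratic_inv_def ff del: inverse_mult_distrib)
  show right: "f (quadratic_inv a b f x) = x" for x
    using ab by (simp add: quadratic_inv_def endo_simps[OF fe] ff del: inverse_mult_distrib)
  show "endo scale (quadratic_inv a b f)"
    by (simp add: endo_iff quadratic_inv_def endo_simps[OF fe] algebra_simps)
  show "bij f" "bij (quadratic_inv a b f)"
    by (rule o_bij[where g = "quadratic_inv a b f"], simp_all add: fun_eq_iff left right)
      (rule o_bij[where g = f], simp_all add: fun_eq_iff left right)
qed

text \<open>Cayley-Hamilton for a 2-by-2 matrix with trace \<open>a + b\<close> and determinant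
  \<open>a * b\<close>; \<open>x\<close> and \<open>y\<close> need not be independent.\<close>

lemma two_by_two_quadratic:
  assumes f: "endo scale f" and x: "f x = p *s x + q *s y" and y: "f y = p' *s x + q' *s y"
    and "a + b = p + q'" "a * b = p * q' - p' * q"
  shows "f (f x) = (a + b) *s f x - (a * b) *s x" "f (f y) = (a + b) *s f y - (a * b) *s y"
  unfolding assms(4,5)
  by (simp_all add: x y endo_simps[OF f] algebra_simps)

text \<open>An infinite set is equipotent to its product with \<open>bool\<close>, so
  \<open>F\<close> splits into disjoint pairs indexed by \<open>F\<close> itself. The last property
  then allows operators to be defined pair by pair, as 2-by-2 blocks.\<close>

lemma infinite_pairing:
  assumes "infinite F" "independent F"
  obtains y y' where "\<And>x. x \<in> F \<Longrightarrow> y x \<in> F" "\<And>x. x \<in> F \<Longrightarrow> y' x \<in> F"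
    "\<And>z. z \<in> F \<Longrightarrow> \<exists>x\<in>F. z = y x \<or> z = y' x"
    "\<And>h h'. \<exists>f. endo scale f \<and> (\<forall>x\<in>F. f (y x) = h x \<and> f (y' x) = h' x)"
proof -
  have "|UNIV :: bool set| \<le>o |F|"
    by (rule ordLeq3_finite_infinite) (use assms in auto)
  then have "|F \<times> (UNIV :: bool set)| =o |F|"
    using card_of_Times_infinite[OF assms(1), of "UNIV :: bool set"] by simp
  then obtain g where g: "bij_betw g (F \<times> (UNIV :: bool set)) F"
    using card_of_ordIso by blast
  define y y' where "y x = g (x, True)" and "y' x = g (x, False)" for x
  have ex: "\<exists>f. endo scale f \<and> (\<forall>x\<in>F. f (y x) = h x \<and> f (y' x) = h' x)" for h h' :: "'b \<Rightarrow> 'b"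
  proof -
    define H where "H z = (case inv_into (F \<times> UNIV) g z of (x, i) \<Rightarrow> if i then h x else h' x)" for z
    obtain f where "endo scale f" "\<forall>z\<in>F. f z = H z"
      using endo_extend[OF assms(2)] by blast
    moreover have "H (g (x, i)) = (if i then h x else h' x)" if "x \<in> F" for x i
      using that inv_into_f_f[OF bij_betw_imp_inj_on[OF g], of "(x, i)"] by (simp add: H_def)
    moreover have "g (x, i) \<in> F" if "x \<in> F" for x i
      using that bij_betwE[OF g] by auto
    ultimately show ?thesis
      by (intro exI[of _ f]) (simp add: y_def y'_def)
  qed
  have cover: "\<exists>x\<in>F. z = y x \<or> z = y' x" if "z \<in> F" for z
  proof -
    from that obtain x i where "x \<in> F" "z = g (x, i)"
      using bij_betw_imp_surj_on[OF g] by force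
    then show ?thesis
      by (cases i) (auto simp: y_def y'_def)
  qed
  have "y x \<in> F" "y' x \<in> F" if "x \<in> F" for x
    using that bij_betwE[OF g] by (auto simp: y_def y'_def)
  then show thesis
    by (rule that[OF _ _ cover ex])
qed

text \<open>If \<open>l\<close> is not a product of roots, the factors come in 2-by-2 blocks: the trace of the product
  of two triangular matrices with diagonals \<open>(a1, b1)\<close> and \<open>(a2, b2)\<close> is arbitrary, so it can be
  chosen such that \<open>l\<close> times the inverse of this product has trace \<open>a3 + b3\<close>.\<close>

lemma scalar_factorization:
  assumes F: "infinite F" "independent F"
    and nz: "l \<noteq> 0" "a1 * b1 \<noteq> 0" "a2 * b2 \<noteq> 0"
    and acc: "(\<exists>x1 x2 x3. x1 \<in> {a1, b1} \<and> x2 \<in> {a2, b2} \<and> x3 \<in> {a3, b3} \<and> l = x1 * x2 * x3) \<or>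
      l\<^sup>2 = (a1 * b1) * (a2 * b2) * (a3 * b3)"
  obtains f1 f2 f3 where "endo scale f1" "endo scale f2" "endo scale f3"
    "\<And>x. x \<in> F \<Longrightarrow> f1 x \<in> span F" "\<And>x. x \<in> F \<Longrightarrow> f2 x \<in> span F" "\<And>x. x \<in> F \<Longrightarrow> f3 x \<in> span F"
    "\<And>x. x \<in> F \<Longrightarrow> f1 (f1 x) = (a1 + b1) *s f1 x - (a1 * b1) *s x"
    "\<And>x. x \<in> F \<Longrightarrow> f2 (f2 x) = (a2 + b2) *s f2 x - (a2 * b2) *s x"
    "\<And>x. x \<in> F \<Longrightarrow> f3 (f3 x) = (a3 + b3) *s f3 x - (a3 * b3) *s x"
    "\<And>x. x \<in> F \<Longrightarrow> f1 (f2 (f3 x)) = l *s x"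
  using acc
proof
  assume "\<exists>x1 x2 x3. x1 \<in> {a1, b1} \<and> x2 \<in> {a2, b2} \<and> x3 \<in> {a3, b3} \<and> l = x1 * x2 * x3"
  then obtain x1 x2 x3 where x: "x1 \<in> {a1, b1}" "x2 \<in> {a2, b2}" "x3 \<in> {a3, b3}" "l = x1 * x2 * x3"
    by blast
  show thesis
    by (rule that[of "scale x1" "scale x2" "scale x3"])
      (use x in \<open>auto simp: endo_iff scale_right_distrib span_base span_scale algebra_simps\<close>)
next
  assume l2: "l\<^sup>2 = (a1 * b1) * (a2 * b2) * (a3 * b3)"
  obtain y y' where yF: "\<And>x. x \<in> F \<Longrightarrow> y x \<in> F" "\<And>x. x \<in> F \<Longrightarrow> y' x \<in> F"
    and cover: "\<And>z. z \<in> F \<Longrightarrow> \<exists>x\<in>F. z = y x \<or> z = y' x"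
    and ex: "\<And>h h'. \<exists>f. endo scale f \<and> (\<forall>x\<in>F. f (y x) = h x \<and> f (y' x) = h' x)"
    by (rule infinite_pairing[OF F]) (rule that)
  \<comment> \<open>On each pair, \<open>f1 f2\<close> will have determinant \<open>n\<close> and
    trace \<open>a1 * a2 + b1 * b2 + m\<close>. The choice of \<open>m\<close> makes this trace
    \<open>(a3 + b3) * n / l\<close>.\<close>
  define n where "n = (a1 * b1) * (a2 * b2)"
  define m where "m = (a3 + b3) * n / l - a1 * a2 - b1 * b2"
  define d where "d = l / n"
  have n0: "n \<noteq> 0" using nz by (simp add: n_def)
  have op: "\<exists>f. endo scale f \<and> (\<forall>x\<in>F. f (y x) = p *s y x + q *s y' x \<and> f (y' x) = p' *s y x + q' *s y' x)"
    for p q p' q'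
    by (rule ex[of "\<lambda>x. p *s y x + q *s y' x" "\<lambda>x. p' *s y x + q' *s y' x"])
  obtain f1 where f1: "endo scale f1" "\<And>x. x \<in> F \<Longrightarrow> f1 (y x) = a1 *s y x + 0 *s y' x"
      "\<And>x. x \<in> F \<Longrightarrow> f1 (y' x) = 1 *s y x + b1 *s y' x"
    using op by metis
  obtain f2 where f2: "endo scale f2" "\<And>x. x \<in> F \<Longrightarrow> f2 (y x) = a2 *s y x + m *s y' x"
      "\<And>x. x \<in> F \<Longrightarrow> f2 (y' x) = 0 *s y x + b2 *s y' x"
    using op by metis
  \<comment> \<open>The block is \<open>d\<close> times the adjugate of the block of
    \<open>f1 f2\<close>, that is, \<open>l\<close> times its inverse.\<close>
  obtain f3 where f3: "endo scale f3"
      "\<And>x. x \<in> F \<Longrightarrow> f3 (y x) = (d * (b1 * b2)) *s y x + (- (d * (b1 * m))) *s y' x"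
      "\<And>x. x \<in> F \<Longrightarrow> f3 (y' x) = (- (d * b2)) *s y x + (d * (a1 * a2 + m)) *s y' x"
    using op by metis
  have tr: "a3 + b3 = d * (b1 * b2) + d * (a1 * a2 + m)"
    using nz n0 by (simp add: d_def m_def field_simps)
  \<comment> \<open>The determinant of \<open>f3\<close> is \<open>l\<^sup>2 / n\<close>; the norm
    equation is exactly what makes it \<open>a3 * b3\<close>.\<close>
  have det: "a3 * b3 = (d * (b1 * b2)) * (d * (a1 * a2 + m)) - (- (d * b2)) * (- (d * (b1 * m)))"
  proof -
    have "(d * (b1 * b2)) * (d * (a1 * a2 + m)) - (- (d * b2)) * (- (d * (b1 * m))) = d\<^sup>2 * n"
      by (simp add: n_def power2_eq_square algebra_simps)
    also have "\<dots> = a3 * b3"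
      using n0 l2 by (simp add: d_def power_divide) (simp add: n_def power2_eq_square)
    finally show ?thesis ..
  qed
  have dn: "d * n = l" using n0 by (simp add: d_def)
  have coverE: "Q z" if "z \<in> F" "\<And>x. x \<in> F \<Longrightarrow> Q (y x) \<and> Q (y' x)" for z Q
    using cover that by blast
  show thesis
  proof (rule that[OF f1(1) f2(1) f3(1)])
    show "f1 x \<in> span F" "f2 x \<in> span F" "f3 x \<in> span F" if "x \<in> F" for x
      by (rule coverE[OF that]; use yF in \<open>simp add: f1 f2 f3 span_base span_scale span_add span_diff\<close>)+
    show "f1 (f1 x) = (a1 + b1) *s f1 x - (a1 * b1) *s x" if "x \<in> F" for x
      by (rule coverE[OF that]) (intro conjI two_by_two_quadratic[OF f1]; simp)
    show "f2 (f2 x) = (a2 + b2) *s f2 x - (a2 * b2) *s x" if "x \<in> F" for x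
      by (rule coverE[OF that]) (intro conjI two_by_two_quadratic[OF f2]; simp)
    show "f3 (f3 x) = (a3 + b3) *s f3 x - (a3 * b3) *s x" if "x \<in> F" for x
      by (rule coverE[OF that]) (intro conjI two_by_two_quadratic[OF f3 tr det])
    show "f1 (f2 (f3 x)) = l *s x" if "x \<in> F" for x
      by (rule coverE[OF that])
        (simp add: f1(2,3) f2(2,3) f3(2,3) endo_simps[OF f1(1)] endo_simps[OF f2(1)] dn[symmetric] n_def
          algebra_simps)
  qed
qed

end

section \<open>Operators along a ranked chain basis\<close>

locale chain_basis = endo_algebra +
  fixes K F :: "'b set" and s e :: "'b \<Rightarrow> 'b" and r :: "'b \<Rightarrow> nat"
  assumes indep: "independent (K \<union> e ` K \<union> F)"
    and total: "span (K \<union> e ` K \<union> F) = UNIV"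
    and inj_e: "inj_on e K"
    and disj: "K \<inter> e ` K = {}" "K \<inter> F = {}" "e ` K \<inter> F = {}"
    and inj_s: "inj_on s K"
    and s_mem: "k \<in> K \<Longrightarrow> s k \<in> K"
    and rank_s: "k \<in> K \<Longrightarrow> r k < r (s k)"
begin

abbreviation below :: "'b \<Rightarrow> 'b set" where
  "below k \<equiv> span {j \<in> K. r j < r k}"

section \<open>Endomorphisms prescribed on the chain basis\<close>

lemma endo_eqI:
  assumes "endo scale f" "endo scale g" "\<And>k. k \<in> K \<Longrightarrow> f k = g k"
    "\<And>k. k \<in> K \<Longrightarrow> f (e k) = g (e k)" "\<And>x. x \<in> F \<Longrightarrow> f x = g x"
  shows "f = g"
proof
  fix x
  show "f x = g x"
    by (rule endo_span_eq[OF assms(1,2), of _ "K \<union> e ` K \<union> F"]) (use assms(3-) total in auto)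
qed

lemma endo_on_basis:
  obtains f where "endo scale f" "\<And>k. k \<in> K \<Longrightarrow> f k = h k" "\<And>k. k \<in> K \<Longrightarrow> f (e k) = h' k"
    "\<And>x. x \<in> F \<Longrightarrow> f x = h'' x"
proof -
  define H where "H x = (if x \<in> K then h x else if x \<in> F then h'' x else h' (inv_into K e x))" for x
  obtain f where f: "endo scale f" "\<forall>b\<in>K \<union> e ` K \<union> F. f b = H b"
    using endo_extend[OF indep] by blast
  have "e k \<notin> K" "e k \<notin> F" if "k \<in> K" for k
    using disj that by auto
  moreover have "k \<notin> K" if "k \<in> F" for k
    using disj that by auto
  ultimately show thesis
    using f(2) by (intro that[OF f(1)]) (auto simp: H_def inv_into_f_f[OF inj_e])
qed

text \<open>This is the common shape of \<open>u \<circ> inv g\<close> and of the explicit product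
  of two quadratic operators. The parameters \<open>l\<close>, \<open>b\<close> and \<open>L\<close>
  may differ between the two: the conjugacy class will depend only on the action on
  \<open>F\<close>. Whatever is unknown about \<open>u\<close> on \<open>K\<close> is absorbed in
  the lower term \<open>L\<close>.\<close>

definition chain_op :: "'a \<Rightarrow> 'a \<Rightarrow> ('b \<Rightarrow> 'b) \<Rightarrow> ('b \<Rightarrow> 'b) \<Rightarrow> bool" where
  "chain_op l b L v \<longleftrightarrow> endo scale v \<and> bij v \<and> l \<noteq> 0 \<and>
     (\<forall>k\<in>K. v k = L k + l *s e k + s k \<and> v (e k) = b *s (l *s e k + s k) \<and> L k \<in> below (s k)) \<and>
     (\<forall>x\<in>F. v x \<in> span F)"

text \<open>Eliminating \<open>e k\<close> from the two formulas for \<open>v\<close> leaves a relation that determines the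
  image of \<open>s k\<close> under an intertwiner from images of vectors of smaller rank.\<close>

lemma intertwiner_ex:
  assumes v: "chain_op l b L v"
    and t: "endo scale t" "bij t" "\<And>x. x \<in> F \<Longrightarrow> t x = v x"
  shows "\<exists>P. endo scale P \<and> (\<forall>x. P (v x) = t (P x)) \<and> (\<forall>x\<in>K - s ` K. P x = x) \<and> (\<forall>x\<in>F. P x = x)"
proof -
  have ve: "endo scale v" and l0: "l \<noteq> 0"
    and vk: "\<And>k. k \<in> K \<Longrightarrow> v k = L k + l *s e k + s k"
    and vek: "\<And>k. k \<in> K \<Longrightarrow> v (e k) = b *s (l *s e k + s k)"
    and Lk: "\<And>k. k \<in> K \<Longrightarrow> L k \<in> below (s k)"
    and vF: "\<And>x. x \<in> F \<Longrightarrow> v x \<in> span F"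
    using v by (auto simp: chain_op_def)
  \<comment> \<open>With \<open>X = v k - L k\<close> the formulas give \<open>v (e k) = b X\<close>
    and \<open>l e k = X - s k\<close>, hence \<open>v (s k) = v X - (b * l) X\<close>. An
    intertwiner must therefore send \<open>s k\<close> to
    \<open>G (t (P k) - P (L k))\<close>.\<close>
  define G where "G x = x - (b * l) *s inv t x" for x
  have tG: "t (G x) = t x - (b * l) *s x" for x
    by (simp add: G_def endo_simps[OF t(1)] surj_f_inv_f[OF bij_is_surj[OF t(2)]])
  define val where "val Q k = (if k \<in> s ` K then let j = inv_into K s k in G (t (Q j) - Q (L j)) else k)"
    for Q :: "'b \<Rightarrow> 'b" and k
  define step where "step Q = (SOME f. endo scale f \<and> (\<forall>k\<in>K. f k = val Q k))" for Q
  have step: "endo scale (step Q) \<and> (\<forall>k\<in>K. step Q k = val Q k)" for Q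
  proof -
    have "\<exists>f. endo scale f \<and> (\<forall>k\<in>K. f k = val Q k)"
      by (rule endo_on_basis[of "val Q" id id]) blast
    then show ?thesis
      unfolding step_def by (rule someI_ex)
  qed
  \<comment> \<open>Iteration from zero replaces recursion on rank: at stage \<open>n\<close> the
    values on vectors of rank below \<open>n\<close> have stabilized.\<close>
  define Ps where "Ps n = (step ^^ n) (\<lambda>_. 0)" for n
  have Ps_endo: "endo scale (Ps n)" for n
    by (cases n) (auto simp: Ps_def step, simp add: endo_iff)
  have Ps_base: "Ps (Suc n) k = k" if "k \<in> K - s ` K" for n k
    using that step by (auto simp: Ps_def val_def)
  have Ps_step: "Ps (Suc n) (s k) = G (t (Ps n k) - Ps n (L k))" if "k \<in> K" for n k
    using that step s_mem by (auto simp: Ps_def val_def Let_def inv_into_f_f[OF inj_s])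
  have stable: "\<forall>k\<in>K. r k < n \<longrightarrow> Ps (Suc n) k = Ps n k" for n
  proof (induction n)
    case (Suc n)
    show ?case
    proof (intro ballI impI)
      fix k assume k: "k \<in> K" "r k < Suc n"
      show "Ps (Suc (Suc n)) k = Ps (Suc n) k"
      proof (cases "k \<in> s ` K")
        case False
        then show ?thesis using Ps_base k by simp
      next
        case True
        then obtain j where j: "j \<in> K" "k = s j" by blast
        with rank_s[of j] k have rj: "r j < n" by simp
        have "Ps (Suc n) (L j) = Ps n (L j)"
          by (rule endo_span_eq[OF Ps_endo Ps_endo Lk[OF j(1)]]) (use Suc.IH k j in auto)
        then show ?thesis
          using Suc.IH rj j by (simp add: Ps_step)
      qed
    qed
  qed simp
  have limit: "Ps n k = Ps (Suc (r k)) k" if "k \<in> K" "r k < n" for n k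
  proof -
    from that(2) have "Suc (r k) \<le> n" by simp
    then show ?thesis
      by (induction n rule: dec_induct) (use stable that(1) in auto)
  qed
  \<comment> \<open>\<open>Suc (r k)\<close> is the first stage at which \<open>k\<close> is sure to
    be settled. Only the values of \<open>P0\<close> on \<open>K\<close> matter.\<close>
  obtain P0 where P0: "endo scale P0" "\<And>k. k \<in> K \<Longrightarrow> P0 k = Ps (Suc (r k)) k"
    by (rule endo_on_basis[of "\<lambda>k. Ps (Suc (r k)) k" id id]) (rule that)
  have P0_Ps: "P0 k = Ps n k" if "k \<in> K" "r k < n" for k n
    using P0(2) limit[OF that] that(1) by metis
  have P0_base: "P0 k = k" if "k \<in> K - s ` K" for k
    using P0 Ps_base that by simp
  have P0_s: "P0 (s k) = G (t (P0 k) - P0 (L k))" if k: "k \<in> K" for k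
  proof -
    have "P0 (L k) = Ps (r (s k)) (L k)"
      by (rule endo_span_eq[OF P0(1) Ps_endo Lk[OF k]]) (use P0_Ps in auto)
    moreover have "P0 k = Ps (r (s k)) k"
      using P0_Ps k rank_s by simp
    ultimately show ?thesis
      using Ps_step[OF k, of "r (s k)"] P0(2) s_mem[OF k] by metis
  qed
  \<comment> \<open>The value at \<open>e k\<close> is found by solving
    \<open>P (v k) = t (P k)\<close> for it, which is possible since \<open>l\<close> is
    nonzero.\<close>
  obtain P where P: "endo scale P" "\<And>k. k \<in> K \<Longrightarrow> P k = P0 k"
      "\<And>k. k \<in> K \<Longrightarrow> P (e k) = inverse l *s (t (P0 k) - P0 (L k) - P0 (s k))"
      "\<And>x. x \<in> F \<Longrightarrow> P x = x"
    by (rule endo_on_basis[of P0 "\<lambda>k. inverse l *s (t (P0 k) - P0 (L k) - P0 (s k))" "\<lambda>x. x"])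
      (rule that)
  have PL: "P (L k) = P0 (L k)" if "k \<in> K" for k
    by (rule endo_span_eq[OF P(1) P0(1) Lk[OF that]]) (use P in auto)
  have "(\<lambda>x. P (v x)) = (\<lambda>x. t (P x))"
  proof (rule endo_eqI)
    show "endo scale (\<lambda>x. P (v x))" "endo scale (\<lambda>x. t (P x))"
      using P(1) ve t(1) by (simp_all add: endo_comp)
    fix k assume k: "k \<in> K"
    define X where "X = t (P0 k) - P0 (L k)"
    have Pk: "P k = P0 k" "P (s k) = P0 (s k)" and lPe: "l *s P (e k) = X - P0 (s k)"
      using P(2,3) k s_mem[OF k] l0 by (simp_all add: X_def)
    have "P (v k) = P0 (L k) + l *s P (e k) + P0 (s k)"
      by (simp only: vk[OF k] endo_add[OF P(1)] endo_scale[OF P(1)] PL[OF k] Pk)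
    then show "P (v k) = t (P k)"
      by (simp add: lPe Pk X_def)
    have "P (v (e k)) = b *s (l *s P (e k) + P0 (s k))"
      by (simp only: vek[OF k] endo_add[OF P(1)] endo_scale[OF P(1)] Pk)
    then have PvE: "l *s P (v (e k)) = (b * l) *s X"
      by (simp add: lPe mult.commute)
    \<comment> \<open>Here \<open>P0 (s k) = G X\<close>; the design of \<open>G\<close> yields the
      remaining relation, the one at \<open>e k\<close>.\<close>
    have "t (P0 (s k)) = t X - (b * l) *s X"
      unfolding X_def P0_s[OF k] tG ..
    then have "l *s t (P (e k)) = (b * l) *s X"
      by (simp only: endo_scale[OF t(1), symmetric] lPe endo_diff[OF t(1)]) simp
    with PvE have "l *s P (v (e k)) = l *s t (P (e k))"
      by simp
    then show "P (v (e k)) = t (P (e k))"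
      using l0 by simp
  next
    fix x assume x: "x \<in> F"
    have "P (v x) = v x"
      by (rule endo_span_eq[OF P(1) _ vF[OF x]]) (use P in \<open>auto simp: endo_iff\<close>)
    then show "P (v x) = t (P x)" using t(3) P x by simp
  qed
  then show ?thesis
    using P P0_base by (intro exI[of _ P]) (auto simp: fun_eq_iff)
qed

text \<open>The elimination that builds intertwiners also makes them unique: \<open>v (s k)\<close>
  is expressed through \<open>v\<close>, \<open>k\<close> and \<open>L k\<close>, so fixed points
  propagate along the chains by induction on rank, and then to each \<open>e k\<close>.\<close>

lemma commuting_eq_id:
  assumes v: "chain_op l b L v"
    and T: "endo scale T" "\<And>x. T (v x) = v (T x)" "\<And>x. x \<in> K - s ` K \<Longrightarrow> T x = x" "\<And>x. x \<in> F \<Longrightarrow> T x = x"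
  shows "T = (\<lambda>x. x)"
proof -
  have ve: "endo scale v" "bij v" and l0: "l \<noteq> 0"
    and vk: "\<And>k. k \<in> K \<Longrightarrow> v k = L k + l *s e k + s k"
    and vek: "\<And>k. k \<in> K \<Longrightarrow> v (e k) = b *s (l *s e k + s k)"
    and Lk: "\<And>k. k \<in> K \<Longrightarrow> L k \<in> below (s k)"
    using v by (auto simp: chain_op_def)
  have id: "endo scale (\<lambda>x. x)" by (simp add: endo_iff)
  have ek: "l *s e k = v k - L k - s k" if "k \<in> K" for k
    using vk[OF that] by simp
  have vs: "v (s k) = v (v k - L k) - (b * l) *s (v k - L k)" if "k \<in> K" for k
  proof -
    have "v (l *s e k) = (b * l) *s (v k - L k)"
      using that by (simp add: vek vk endo_scale[OF ve(1)] mult.commute)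
    then show ?thesis
      by (simp add: ek[OF that] endo_simps[OF ve(1)] algebra_simps)
  qed
  have TK: "T k = k" if "k \<in> K" for k
    using that
  proof (induction "r k" arbitrary: k rule: less_induct)
    case less
    show ?case
    proof (cases "k \<in> s ` K")
      case True
      then obtain j where j: "j \<in> K" "k = s j" by blast
      have Tj: "T j = j"
        using less j rank_s by blast
      have TL: "T (L j) = L j"
        by (rule endo_span_eq[OF T(1) id Lk[OF j(1)]]) (use less.hyps j in auto)
      \<comment> \<open>Both sides agree because \<open>j\<close> and \<open>L j\<close> are fixed
        by \<open>T\<close>; injectivity of \<open>v\<close> then cancels \<open>v\<close>.\<close>
      have "v (T (s j)) = v (s j)"
        using j(1) by (simp add: T(2)[symmetric] vs) (simp add: endo_simps[OF T(1)] T(2) Tj TL)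
      then show ?thesis
        using j ve(2) by (metis bij_pointE)
    qed (use less T in auto)
  qed
  show ?thesis
  proof (rule endo_eqI[OF T(1) id])
    fix k assume k: "k \<in> K"
    have "T (L k) = L k"
      by (rule endo_span_eq[OF T(1) id Lk[OF k]]) (use TK in auto)
    then have "T (l *s e k) = l *s e k"
      using k s_mem[OF k] by (simp add: ek endo_simps[OF T(1)] T(2) TK)
    then show "T (e k) = e k"
      using l0 by (simp add: endo_scale[OF T(1)])
  qed (use TK T in auto)
qed

lemma chain_ops_conjugate:
  assumes v: "chain_op l b L v" and t: "chain_op l' b' L' t" and "\<And>x. x \<in> F \<Longrightarrow> t x = v x"
  obtains P P' where "endo scale P" "endo scale P'" "\<And>x. P (P' x) = x" "\<And>x. P' (P x) = x"
    "\<And>x. v x = P' (t (P x))"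
proof -
  have ve: "endo scale v" "bij v" and te: "endo scale t" "bij t"
    using v t by (simp_all add: chain_op_def)
  from intertwiner_ex[OF v te assms(3)] obtain P where P: "endo scale P" "\<And>x. P (v x) = t (P x)"
      "\<And>x. x \<in> K - s ` K \<Longrightarrow> P x = x" "\<And>x. x \<in> F \<Longrightarrow> P x = x"
    by metis
  from intertwiner_ex[OF t ve assms(3)[symmetric]] obtain P' where P': "endo scale P'"
      "\<And>x. P' (t x) = v (P' x)" "\<And>x. x \<in> K - s ` K \<Longrightarrow> P' x = x" "\<And>x. x \<in> F \<Longrightarrow> P' x = x"
    by metis
  have "(\<lambda>x. P (P' x)) = (\<lambda>x. x)"
    by (rule commuting_eq_id[OF t]) (simp_all add: P P' endo_comp)
  moreover have PP: "(\<lambda>x. P' (P x)) = (\<lambda>x. x)"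
    by (rule commuting_eq_id[OF v]) (simp_all add: P P' endo_comp)
  moreover have "P' (t (P x)) = v x" for x
    using fun_cong[OF PP, of "v x"] by (simp only: P(2))
  ultimately show thesis
    by (intro that[OF P(1) P'(1)]) (metis+)
qed

section \<open>Factorization of \<open>u\<close> along a chain basis\<close>

lemma quadratic_basisI:
  assumes f: "endo scale f"
    and "\<And>k. k \<in> K \<Longrightarrow> f (f k) = (a + b) *s f k - (a * b) *s k"
    and "\<And>k. k \<in> K \<Longrightarrow> f (f (e k)) = (a + b) *s f (e k) - (a * b) *s e k"
    and "\<And>x. x \<in> F \<Longrightarrow> f (f x) = (a + b) *s f x - (a * b) *s x"
  shows "quadratic a b f"
  unfolding quadratic_def
proof (intro conjI allI f)
  fix x
  show "f (f x) = (a + b) *s f x - (a * b) *s x"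
    by (rule quadratic_on_span[OF f, of _ "K \<union> e ` K \<union> F"]) (use assms(2-4) total in auto)
qed

text \<open>With \<open>B\<close> the inverse of a quadratic \<open>A3\<close>, it suffices that
  \<open>u \<circ> B\<close> is conjugate to \<open>A1 \<circ> A2\<close>: conjugating
  \<open>A1\<close> and \<open>A2\<close> separately and leaving \<open>A3\<close> alone then gives
  \<open>u\<close>.\<close>

lemma factorization:
  assumes u: "endo scale u" "bij u"
    and ue: "\<And>k. k \<in> K \<Longrightarrow> u (e k) = l *s e k + s k"
    and uk: "\<And>k. k \<in> K \<Longrightarrow> u k \<in> below (s k)"
    and uF: "\<And>x. x \<in> F \<Longrightarrow> u x = l *s x"
    and F: "infinite F"
    and nz: "l \<noteq> 0" "a1 * b1 \<noteq> 0" "a2 * b2 \<noteq> 0" "a3 * b3 \<noteq> 0"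
    and acc: "(\<exists>x1 x2 x3. x1 \<in> {a1, b1} \<and> x2 \<in> {a2, b2} \<and> x3 \<in> {a3, b3} \<and> l = x1 * x2 * x3) \<or>
      l\<^sup>2 = (a1 * b1) * (a2 * b2) * (a3 * b3)"
  obtains g1 g2 g3 where "quadratic a1 b1 g1" "quadratic a2 b2 g2" "quadratic a3 b3 g3"
    "\<And>x. u x = g1 (g2 (g3 x))"
proof -
  have indF: "independent F"
    using indep by (rule independent_mono) blast
  obtain f1 f2 f3 where f: "endo scale f1" "endo scale f2" "endo scale f3"
    and f_mem: "\<And>x. x \<in> F \<Longrightarrow> f1 x \<in> span F" "\<And>x. x \<in> F \<Longrightarrow> f2 x \<in> span F" "\<And>x. x \<in> F \<Longrightarrow> f3 x \<in> span F"
    and f1: "\<And>x. x \<in> F \<Longrightarrow> f1 (f1 x) = (a1 + b1) *s f1 x - (a1 * b1) *s x"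
    and f2: "\<And>x. x \<in> F \<Longrightarrow> f2 (f2 x) = (a2 + b2) *s f2 x - (a2 * b2) *s x"
    and f3: "\<And>x. x \<in> F \<Longrightarrow> f3 (f3 x) = (a3 + b3) *s f3 x - (a3 * b3) *s x"
    and fff: "\<And>x. x \<in> F \<Longrightarrow> f1 (f2 (f3 x)) = l *s x"
    by (rule scalar_factorization[OF F indF nz(1-3) acc]) (rule that)
  \<comment> \<open>\<open>A1\<close> and \<open>A2\<close> are triangular, with
    \<open>A1 - b1\<close> vanishing on \<open>s k \<in> K\<close>, and are chosen so that
    \<open>A1 \<circ> A2\<close> has the shape of \<open>chain_op\<close>.\<close>
  obtain A1 where A1: "endo scale A1" "\<And>k. k \<in> K \<Longrightarrow> A1 k = b1 *s k"
      "\<And>k. k \<in> K \<Longrightarrow> A1 (e k) = a1 *s e k + s k" "\<And>x. x \<in> F \<Longrightarrow> A1 x = f1 x"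
    by (rule endo_on_basis[of "scale b1" "\<lambda>k. a1 *s e k + s k" f1]) (rule that)
  obtain A2 where A2: "endo scale A2" "\<And>k. k \<in> K \<Longrightarrow> A2 k = a2 *s k + 1 *s e k"
      "\<And>k. k \<in> K \<Longrightarrow> A2 (e k) = 0 *s k + b2 *s e k" "\<And>x. x \<in> F \<Longrightarrow> A2 x = f2 x"
    by (rule endo_on_basis[of "\<lambda>k. a2 *s k + 1 *s e k" "\<lambda>k. 0 *s k + b2 *s e k" f2]) (rule that)
  \<comment> \<open>The coefficient \<open>- (a3 * b3)\<close> gives \<open>e k\<close> the
    coefficient 1 in \<open>B k\<close>, so that \<open>u (B k)\<close> contains exactly
    \<open>l *s e k + s k\<close>.\<close>
  obtain A3 where A3: "endo scale A3" "\<And>k. k \<in> K \<Longrightarrow> A3 k = a3 *s k + (- (a3 * b3)) *s e k"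
      "\<And>k. k \<in> K \<Longrightarrow> A3 (e k) = 0 *s k + b3 *s e k" "\<And>x. x \<in> F \<Longrightarrow> A3 x = f3 x"
    by (rule endo_on_basis[of "\<lambda>k. a3 *s k + (- (a3 * b3)) *s e k" "\<lambda>k. 0 *s k + b3 *s e k" f3]) (rule that)
  have on_F: "A1 x = f1 x" "A2 x = f2 x" "A3 x = f3 x" if "x \<in> span F" for x
    using A1 A2 A3 f by (auto intro: endo_span_eq[OF _ _ that])
  have q1: "quadratic a1 b1 A1"
    by (rule quadratic_basisI[OF A1(1)])
      (use A1 f1 f_mem in \<open>simp_all add: s_mem endo_simps[OF A1(1)] on_F span_base algebra_simps\<close>)
  have q2: "quadratic a2 b2 A2"
  proof (rule quadratic_basisI[OF A2(1)])
    fix k assume k: "k \<in> K"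
    show "A2 (A2 k) = (a2 + b2) *s A2 k - (a2 * b2) *s k"
      "A2 (A2 (e k)) = (a2 + b2) *s A2 (e k) - (a2 * b2) *s e k"
      by (rule two_by_two_quadratic[OF A2(1) A2(2)[OF k] A2(3)[OF k]]; simp)+
  qed (simp add: A2(4) f2 f_mem on_F)
  have q3: "quadratic a3 b3 A3"
  proof (rule quadratic_basisI[OF A3(1)])
    fix k assume k: "k \<in> K"
    show "A3 (A3 k) = (a3 + b3) *s A3 k - (a3 * b3) *s k"
      "A3 (A3 (e k)) = (a3 + b3) *s A3 (e k) - (a3 * b3) *s e k"
      by (rule two_by_two_quadratic[OF A3(1) A3(2)[OF k] A3(3)[OF k]]; simp)+
  qed (simp add: A3(4) f3 f_mem on_F)
  define B where "B = quadratic_inv a3 b3 A3"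
  note B = quadratic_inv[OF q3 nz(4), folded B_def]
  have Bk: "B k = inverse a3 *s k + e k" "B (e k) = inverse b3 *s e k" if "k \<in> K" for k
    using that nz(4) by (simp_all add: B_def quadratic_inv_def A3 algebra_simps)
  have BF: "B x \<in> span F" if "x \<in> F" for x
    using that by (simp add: B_def quadratic_inv_def A3(4) f_mem span_scale span_diff span_base)
  have u_span: "u x = l *s x" if "x \<in> span F" for x
    by (rule endo_span_eq[OF u(1) endo_scalar that]) (rule uF)
  have AAA: "A1 (A2 (A3 x)) = l *s x" if "x \<in> span F" for x
  proof (rule endo_span_eq[OF _ endo_scalar that])
    show "endo scale (\<lambda>x. A1 (A2 (A3 x)))"
      by (rule endo_comp[OF A1(1) endo_comp[OF A2(1) A3(1)]])
    show "A1 (A2 (A3 x)) = l *s x" if "x \<in> F" for x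
      using that endo_span_mem[OF f(2) f_mem(3) f_mem(2)] by (simp add: A3(4) f_mem on_F fff)
  qed
  have v: "chain_op l (inverse b3) (\<lambda>k. inverse a3 *s u k) (\<lambda>x. u (B x))"
    unfolding chain_op_def
  proof (intro conjI ballI)
    show "endo scale (\<lambda>x. u (B x))" "bij (\<lambda>x. u (B x))"
      using B(3,5) u by (simp_all add: endo_comp bij_comp[unfolded comp_def])
    show "u (B x) \<in> span F" if "x \<in> F" for x
      using BF[OF that] by (simp add: u_span span_scale)
    fix k assume k: "k \<in> K"
    show "u (B k) = inverse a3 *s u k + l *s e k + s k" "u (B (e k)) = inverse b3 *s (l *s e k + s k)"
      using k by (simp_all add: Bk endo_simps[OF u(1)] ue)
    show "inverse a3 *s u k \<in> below (s k)"
      using k by (simp add: uk span_scale)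
  qed (fact nz)
  have t: "chain_op a1 b2 (\<lambda>k. (a2 * b1) *s k) (\<lambda>x. A1 (A2 x))"
    unfolding chain_op_def
  proof (intro conjI ballI)
    show "endo scale (\<lambda>x. A1 (A2 x))"
      by (rule endo_comp[OF A1(1) A2(1)])
    show "a1 \<noteq> 0"
      using nz by simp
    show "bij (\<lambda>x. A1 (A2 x))"
      using quadratic_inv(4)[OF q1 nz(2)] quadratic_inv(4)[OF q2 nz(3)]
      by (simp add: bij_comp[unfolded comp_def])
    show "A1 (A2 x) \<in> span F" if "x \<in> F" for x
      using that endo_span_mem[OF f(1) f_mem(2) f_mem(1)] by (simp add: A2(4) f_mem on_F)
    fix k assume k: "k \<in> K"
    show "A1 (A2 k) = (a2 * b1) *s k + a1 *s e k + s k" "A1 (A2 (e k)) = b2 *s (a1 *s e k + s k)"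
      using k by (simp_all add: A2 A1 endo_simps[OF A1(1)])
    show "(a2 * b1) *s k \<in> below (s k)"
      using k by (simp add: span_base span_scale rank_s)
  qed
  \<comment> \<open>On \<open>F\<close> write \<open>x = A3 (B x)\<close>: both sides equal
    \<open>l *s B x\<close>, since the three factors multiply to \<open>l\<close> there.\<close>
  have "A1 (A2 x) = u (B x)" if "x \<in> F" for x
    using AAA[OF BF[OF that]] u_span[OF BF[OF that]] by (simp add: B(2))
  from chain_ops_conjugate[OF v t this] obtain P P' where P: "endo scale P" "endo scale P'"
      "\<And>x. P (P' x) = x" "\<And>x. P' (P x) = x" "\<And>x. u (B x) = P' (A1 (A2 (P x)))"
    by metis
  show thesis
  proof (rule that)
    show "quadratic a1 b1 (\<lambda>x. P' (A1 (P x)))" "quadratic a2 b2 (\<lambda>x. P' (A2 (P x)))" "quadratic a3 b3 A3"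
      using quadratic_conjugate[OF q1 P(1-4)] quadratic_conjugate[OF q2 P(1-4)] q3 by simp_all
    show "u x = P' (A1 (P (P' (A2 (P (A3 x))))))" for x
      using P(5)[of "A3 x"] by (simp add: B(1) P(3))
  qed
qed

end

section \<open>Existence of a ranked chain basis\<close>

lemma card_of_Un_bound: "infinite C \<Longrightarrow> |A| \<le>o |C| \<Longrightarrow> |B| \<le>o |C| \<Longrightarrow> |A \<union> B| \<le>o |C|"
  by (rule card_of_Un_ordLeq_infinite_Field) (simp_all add: card_of_card_order_on Field_card_of)

context endo_algebra
begin

text \<open>All bases have the size of \<open>U\<close>. If the part \<open>Z\<close> added to
  \<open>S\<close> had at most \<open>|D|\<close> elements, so would the whole basis, as
  \<open>D\<close> is infinite.\<close>

lemma basis_extension_card: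
  assumes S: "independent S" "|S| \<le>o |D|" and D: "infinite D"
    and U: "independent U" "span U = UNIV" "|D| <o |U|"
    and N: "span (S \<union> N) = UNIV"
  obtains Z where "Z \<subseteq> N" "S \<inter> Z = {}" "independent (S \<union> Z)" "span (S \<union> Z) = UNIV" "|D| <o |Z|"
proof -
  obtain B where B: "S \<subseteq> B" "B \<subseteq> S \<union> N" "independent B" "S \<union> N \<subseteq> span B"
    using maximal_independent_subset_extend[of S "S \<union> N"] S(1) by blast
  have spB: "span B = UNIV"
    using B(4) N span_minimal[OF B(4)] by auto
  obtain f where "bij_betw f U B"
    using bij_if_span_eq_span_bases[OF U(1) B(3)] U(2) spB by auto
  then have UB: "|U| =o |B|"
    using card_of_ordIsoI by blast
  have SZ: "S \<union> (B - S) = B"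
    using B(1) by blast
  have "|D| <o |B - S|"
  proof (rule ccontr)
    assume "\<not> |D| <o |B - S|"
    then have "|B - S| \<le>o |D|"
      using not_ordLeq_iff_ordLess[OF card_of_Well_order[of D] card_of_Well_order[of "B - S"]] by blast
    then have "|B| \<le>o |D|"
      using card_of_Un_bound[OF D S(2), of "B - S"] by (simp only: SZ)
    then have "|U| \<le>o |D|"
      by (rule ordIso_ordLeq_trans[OF UB])
    then show False
      using not_ordLess_ordLeq[OF U(3)] by contradiction
  qed
  moreover have "B - S \<subseteq> N" "S \<inter> (B - S) = {}"
    using B(2) by auto
  ultimately show thesis
    using that[of "B - S", unfolded SZ] B(3) spB by simp
qed

text \<open>\<open>q\<close> kills the span of \<open>D\<close> and is injective on the span of
  \<open>E\<close>, so these spans meet only in \<open>0\<close>.\<close>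

lemma independent_Un_by_projection:
  assumes D: "independent D" and q: "endo scale q" "\<And>x. x \<in> D \<Longrightarrow> q x = 0"
    and E: "inj_on q E" "independent (q ` E)"
  shows "independent (D \<union> E)" "D \<inter> E = {}"
proof -
  interpret q: module_hom scale scale q
    using q(1) by (simp add: endo_def module_hom_iff_linear)
  have "0 \<notin> q ` E"
    using E(2) dependent_zero by blast
  then show disj: "D \<inter> E = {}"
    using q(2) by force
  have inj: "inj_on q (span E)"
    using q.inj_on_span_iff_independent_image[OF E(2)] E(1) by simp
  have False if x: "x \<in> D \<union> E" "x \<in> span (D \<union> E - {x})" for x
  proof (cases "x \<in> E")
    case True
    have "q x \<in> span (q ` (E - {x}))"
      by (rule endo_span_mem[OF q(1) x(2)]) (use q(2) in \<open>auto intro: span_zero span_base\<close>)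
    moreover have "q ` (E - {x}) = q ` E - {q x}"
      using E(1) True by (auto simp: inj_on_def)
    ultimately show False
      using E(2) True unfolding dependent_def by auto
  next
    case False
    then have "x \<in> D" "D \<union> E - {x} = (D - {x}) \<union> E"
      using x(1) disj by auto
    with x(2) have "x \<in> {y + z |y z. y \<in> span (D - {x}) \<and> z \<in> span E}"
      by (simp only: span_Un)
    then obtain y z where yz: "x = y + z" "y \<in> span (D - {x})" "z \<in> span E"
      by blast
    have "q y = 0"
      by (rule endo_span_eq[OF q(1) _ yz(2), of "\<lambda>_. 0"]) (use q(2) in \<open>auto simp: endo_iff\<close>)
    moreover have "q x = 0"
      using q(2) \<open>x \<in> D\<close> by simp
    ultimately have "q z = q 0"
      using yz(1) by (simp add: endo_simps[OF q(1)])
    then have "z = 0"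
      using inj_onD[OF inj _ yz(3) span_zero] by blast
    then show False
      using yz(1,2) \<open>x \<in> D\<close> D unfolding dependent_def by auto
  qed
  then show "independent (D \<union> E)"
    unfolding dependent_def by blast
qed

text \<open>Every \<open>x\<close> differs by a kernel vector from a combination of the chosen
  preimages with the same image.\<close>

lemma span_Un_kernel:
  assumes w: "endo scale w" "range w \<subseteq> span D" and E: "\<And>d. d \<in> D \<Longrightarrow> \<exists>x\<in>E. w x = d"
  shows "span (E \<union> {x. w x = 0}) = UNIV"
proof -
  have "x \<in> span (E \<union> {x. w x = 0})" for x
  proof -
    have "\<exists>y\<in>span E. w y = z" if "z \<in> span D" for z
      using that
    proof (induction rule: span_induct_alt)
      case base
      then show ?case
        using span_zero[of E] endo_zero[OF w(1)] by blast
    next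
      case (step a d z)
      then obtain x y where "x \<in> E" "w x = d" "y \<in> span E" "w y = z"
        using E by blast
      then show ?case
        by (intro bexI[of _ "a *s x + y"]) (auto simp: endo_simps[OF w(1)] span_add span_scale span_base)
    qed
    then obtain y where y: "y \<in> span E" "w y = w x"
      using w(2) by blast
    then have "x - y \<in> span (E \<union> {x. w x = 0})"
      by (intro span_base) (simp add: endo_simps[OF w(1)])
    moreover have "y \<in> span (E \<union> {x. w x = 0})"
      using y(1) span_mono[of E "E \<union> {x. w x = 0}"] by blast
    ultimately show ?thesis
      using span_add[of "x - y" _ y] by simp
  qed
  then show ?thesis by blast
qed

text \<open>An infinite set is equipotent to its product with the natural numbers, so it can be
  partitioned into infinitely many levels of full size; then \<open>s0\<close> may send each \<open>d\<close> as high as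
  needed and remain injective.\<close>

lemma ranked_injection:
  assumes D: "infinite D" and u: "u ` D \<subseteq> span D"
  obtains s0 :: "'b \<Rightarrow> 'b" and r0 :: "'b \<Rightarrow> nat" where "s0 ` D \<subseteq> D" "inj_on s0 D"
    "\<forall>d\<in>D. r0 d < r0 (s0 d) \<and> u d \<in> span {d' \<in> D. r0 d' < r0 (s0 d)}"
proof -
  have "|UNIV :: nat set| \<le>o |D|"
    using D infinite_iff_card_of_nat by blast
  then have "|D| =o |D \<times> (UNIV :: nat set)|"
    using card_of_Times_infinite[OF D, of "UNIV :: nat set"] ordIso_symmetric by auto
  then obtain g where g: "bij_betw g D (D \<times> (UNIV :: nat set))"
    using card_of_ordIso by blast
  define r0 where "r0 d = snd (g d)" for d
  have level: "\<exists>n. x \<in> span {d' \<in> D. r0 d' \<le> n}" if "x \<in> span D" for x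
    using that
  proof (induction rule: span_induct_alt)
    case base
    then show ?case by (auto intro: span_zero)
  next
    case (step a d x)
    then obtain n where n: "x \<in> span {d' \<in> D. r0 d' \<le> n}" by blast
    have "span {d' \<in> D. r0 d' \<le> n} \<subseteq> span {d' \<in> D. r0 d' \<le> max n (r0 d)}"
      by (rule span_mono) auto
    with n have "x \<in> span {d' \<in> D. r0 d' \<le> max n (r0 d)}"
      by blast
    then show ?case
      using step.hyps by (intro exI[of _ "max n (r0 d)"] span_add span_scale) (auto intro: span_base)
  qed
  \<comment> \<open>A vector of the span involves only finitely many levels; one bound serves for
    both \<open>d\<close> and \<open>u d\<close>.\<close>
  have "\<exists>n. u d \<in> span {d' \<in> D. r0 d' \<le> n} \<and> r0 d \<le> n" if "d \<in> D" for d
  proof -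
    from level[of "u d"] u that obtain n where n: "u d \<in> span {d' \<in> D. r0 d' \<le> n}"
      by blast
    have "span {d' \<in> D. r0 d' \<le> n} \<subseteq> span {d' \<in> D. r0 d' \<le> max n (r0 d)}"
      by (rule span_mono) auto
    with n show ?thesis
      by (intro exI[of _ "max n (r0 d)"]) auto
  qed
  then obtain m where m: "\<And>d. d \<in> D \<Longrightarrow> u d \<in> span {d' \<in> D. r0 d' \<le> m d}" "\<And>d. d \<in> D \<Longrightarrow> r0 d \<le> m d"
    by metis
  \<comment> \<open>The first coordinate \<open>d\<close> makes \<open>s0\<close> injective;
    \<open>Suc\<close> turns the bound \<open>m d\<close> into strict inequalities.\<close>
  define s0 where "s0 d = inv_into D g (d, Suc (m d))" for d
  have s0: "s0 d \<in> D" "g (s0 d) = (d, Suc (m d))" if "d \<in> D" for d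
  proof -
    have "(d, Suc (m d)) \<in> g ` D"
      using that bij_betw_imp_surj_on[OF g] by simp
    then show "s0 d \<in> D" "g (s0 d) = (d, Suc (m d))"
      unfolding s0_def by (simp_all add: inv_into_into f_inv_into_f)
  qed
  have r0_s0: "r0 (s0 d) = Suc (m d)" if "d \<in> D" for d
    using s0[OF that] by (simp add: r0_def)
  show thesis
  proof (rule that)
    show "s0 ` D \<subseteq> D"
      using s0 by blast
    show "inj_on s0 D"
      by (rule inj_onI) (metis s0(2) fst_conv)
    show "\<forall>d\<in>D. r0 d < r0 (s0 d) \<and> u d \<in> span {d' \<in> D. r0 d' < r0 (s0 d)}"
      using m by (auto simp: r0_s0 less_Suc_eq_le)
  qed
qed

text \<open>Any preimages of the basis \<open>D\<close> of the image can be shifted by independent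
  kernel vectors until their span avoids that of \<open>D\<close>. The rest of the basis is taken in
  the kernel, and part of it serves as starts of chains that make \<open>s\<close> onto
  \<open>D\<close>.\<close>

lemma chain_basis_ex:
  assumes u: "endo scale u" and D: "independent D" "span D = range (\<lambda>x. u x - l *s x)" "infinite D"
    and U: "independent U" "span U = UNIV" "|D| <o |U|"
  obtains K F s e r where "chain_basis scale K F s e r" "infinite F"
    "\<And>k. k \<in> K \<Longrightarrow> u (e k) = l *s e k + s k" "\<And>k. k \<in> K \<Longrightarrow> u k \<in> span {j \<in> K. r j < r (s k)}"
    "\<And>x. x \<in> F \<Longrightarrow> u x = l *s x"
proof -
  define w where "w x = u x - l *s x" for x
  define N where "N = {x. w x = 0}"
  have we: "endo scale w"
    by (simp add: w_def endo_iff endo_simps[OF u] algebra_simps)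
  have rw: "range w = span D"
    using D(2) by (simp add: w_def)
  define p where "p d = inv w d" for d
  have wp: "w (p d) = d" if "d \<in> D" for d
    unfolding p_def by (rule f_inv_into_f) (use that rw span_base in auto)
  obtain S where S: "S \<subseteq> D \<union> p ` D" "independent S" "D \<union> p ` D \<subseteq> span S"
    using maximal_independent_subset by blast
  have DpD: "|D \<union> f ` D| \<le>o |D|" for f :: "'b \<Rightarrow> 'b"
    using card_of_mono1[of D D] card_of_image by (intro card_of_Un_bound[OF D(3)]) auto
  have S_card: "|S| \<le>o |D|"
    by (rule ordLeq_transitive[OF card_of_mono1[OF S(1)] DpD])
  have spanN: "span (E \<union> N) = UNIV" if "\<And>d. d \<in> D \<Longrightarrow> \<exists>x\<in>E. w x = d" for E
    unfolding N_def using span_Un_kernel[OF we _ that] rw by blast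
  have "span (p ` D \<union> N) \<subseteq> span (S \<union> N)"
  proof (rule span_minimal)
    have "span S \<subseteq> span (S \<union> N)"
      by (rule span_mono) blast
    then show "p ` D \<union> N \<subseteq> span (S \<union> N)"
      using S(3) span_superset[of "S \<union> N"] by blast
  qed simp
  moreover have "span (p ` D \<union> N) = UNIV"
    by (rule spanN) (use wp in auto)
  ultimately have "span (S \<union> N) = UNIV"
    by blast
  then obtain Z where Z: "Z \<subseteq> N" "S \<inter> Z = {}" "independent (S \<union> Z)" "span (S \<union> Z) = UNIV" "|D| <o |Z|"
    by (rule basis_extension_card[OF S(2) S_card D(3) U]) (rule that)
  from Z(5) obtain h where h: "inj_on h D" "h ` D \<subseteq> Z"
    using card_of_ordLeq[of D Z] ordLess_imp_ordLeq[of "|D|" "|Z|"] by blast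
  \<comment> \<open>The shift by \<open>h d\<close> in the kernel keeps \<open>e0 d\<close> a
    preimage of \<open>d\<close>, but makes it visible modulo the span of \<open>S\<close>.\<close>
  define e0 where "e0 d = p d + h d" for d
  have we0: "w (e0 d) = d" if "d \<in> D" for d
    using wp[OF that] h(2) Z(1) that by (auto simp: e0_def endo_simps[OF we] N_def)
  \<comment> \<open>The projection onto the span of \<open>Z\<close> along that of \<open>S\<close>;
    it kills \<open>D\<close> and maps \<open>e0 d\<close> to \<open>h d\<close>.\<close>
  obtain q where q: "endo scale q" "\<forall>x\<in>S \<union> Z. q x = (if x \<in> S then 0 else x)"
    using endo_extend[OF Z(3), of "\<lambda>x. if x \<in> S then 0 else x"] by blast
  have qS: "q x = 0" if "x \<in> span S" for x
    by (rule endo_span_eq[OF q(1) _ that, of "\<lambda>_. 0"]) (use q(2) in \<open>auto simp: endo_iff\<close>)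
  have qe: "q (e0 d) = h d" if "d \<in> D" for d
  proof -
    have "p d \<in> span S" "h d \<in> Z"
      using that S(3) h(2) by auto
    then have "q (p d) = 0" "q (h d) = h d"
      using qS q(2) Z(2) by auto
    then show ?thesis
      by (simp add: e0_def endo_simps[OF q(1)])
  qed
  have inj_e0: "inj_on e0 D"
    by (rule inj_onI) (metis we0)
  have q_e0: "q ` e0 ` D = h ` D"
    using qe by (auto simp: image_image)
  have "inj_on q (e0 ` D)"
    by (rule inj_on_imageI) (use qe h(1) in \<open>simp add: inj_on_def\<close>)
  moreover have "independent (q ` e0 ` D)"
    unfolding q_e0 by (rule independent_mono[OF Z(3)]) (use h(2) in blast)
  moreover have "q x = 0" if "x \<in> D" for x
    by (rule qS) (use that S(3) in blast)
  ultimately have DE: "independent (D \<union> e0 ` D)" "D \<inter> e0 ` D = {}"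
    using independent_Un_by_projection[OF D(1) q(1)] by simp_all
  \<comment> \<open>The size count is used a second time: the basis is completed by more than
    \<open>|D|\<close> kernel vectors.\<close>
  have "span ((D \<union> e0 ` D) \<union> N) = UNIV"
    by (rule spanN) (use we0 in auto)
  then obtain G where G: "G \<subseteq> N" "(D \<union> e0 ` D) \<inter> G = {}" "independent (D \<union> e0 ` D \<union> G)"
      "span (D \<union> e0 ` D \<union> G) = UNIV" "|D| <o |G|"
    by (rule basis_extension_card[OF DE(1) DpD D(3) U]) (rule that)
  have uG: "u x = l *s x" if "x \<in> G" for x
    using that G(1) by (auto simp: N_def w_def)
  have u_eq: "u x = w x + l *s x" for x
    by (simp add: w_def)
  have uD: "u ` D \<subseteq> span D"
    unfolding u_eq using rw by (auto intro: span_add span_scale span_base)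
  obtain s0 and r0 :: "'b \<Rightarrow> nat" where s0: "s0 ` D \<subseteq> D" "inj_on s0 D"
      "\<forall>d\<in>D. r0 d < r0 (s0 d) \<and> u d \<in> span {d' \<in> D. r0 d' < r0 (s0 d)}"
    by (rule ranked_injection[OF D(3) uD]) (rule that)
  \<comment> \<open>Each \<open>e0 d\<close> must be \<open>e k\<close> for some \<open>k\<close>,
    so the points missed by \<open>s0\<close> need new predecessors. They are taken from
    \<open>G\<close>, which is large enough.\<close>
  define C where "C = D - s0 ` D"
  have C_card: "|C| \<le>o |D|"
    unfolding C_def by (rule card_of_mono1) blast
  obtain c where c: "inj_on c C" "c ` C \<subseteq> G"
    using card_of_ordLeq[of C G] ordLess_imp_ordLeq[OF ordLeq_ordLess_trans[OF C_card G(5)]] by blast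
  define K where "K = D \<union> c ` C"
  define F where "F = G - c ` C"
  define s where "s k = (if k \<in> D then s0 k else inv_into C c k)" for k
  \<comment> \<open>The \<open>Suc\<close> reserves rank 0 for the added predecessors
    \<open>c i\<close>, which lie below all of \<open>D\<close>.\<close>
  define r where "r k = (if k \<in> D then Suc (r0 k) else 0)" for k
  define e where "e k = e0 (s k)" for k
  have cD: "c i \<notin> D" if "i \<in> C" for i
    using that c(2) G(2) by blast
  have sc: "s (c i) = i" if "i \<in> C" for i
    using that cD c(1) by (simp add: s_def)
  have sD: "s ` D = s0 ` D"
    by (rule image_cong) (simp_all add: s_def)
  have scC: "s ` c ` C = C"
    by (simp add: image_image sc)
  have sK: "s ` K = D"
    unfolding K_def image_Un sD scC unfolding C_def using s0(1) by blast
  have inj_s: "inj_on s K"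
  proof -
    have "inj_on s D"
      using s0(2) by (simp add: s_def inj_on_def)
    moreover have "inj_on s (c ` C)"
      by (rule inj_onI) (metis imageE sc)
    moreover have "s ` (D - c ` C) \<inter> s ` (c ` C - D) = {}"
      using sD scC unfolding C_def by blast
    ultimately show ?thesis
      unfolding K_def inj_on_Un by blast
  qed
  have eK: "e ` K = e0 ` D"
    unfolding e_def sK[symmetric] by (simp add: image_image)
  have KEF: "K \<union> e ` K \<union> F = D \<union> e0 ` D \<union> G"
    unfolding eK unfolding K_def F_def using c(2) by blast
  have s_D: "s k \<in> D" if "k \<in> K" for k
    using that sK by blast
  have cb: "chain_basis scale K F s e r"
  proof unfold_locales
    show "independent (K \<union> e ` K \<union> F)" "span (K \<union> e ` K \<union> F) = UNIV"
      using G(3,4) by (simp_all add: KEF)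
    show "inj_on e K"
      using comp_inj_on[OF inj_s, of e0] inj_e0 by (simp add: sK e_def[abs_def] comp_def)
    show "K \<inter> e ` K = {}" "K \<inter> F = {}" "e ` K \<inter> F = {}"
      unfolding eK unfolding K_def F_def using DE(2) G(2) c(2) by blast+
    show "inj_on s K" by fact
    show "s k \<in> K" if "k \<in> K" for k
      using s_D[OF that] by (simp add: K_def)
    show "r k < r (s k)" if "k \<in> K" for k
      using s_D[OF that] s0(3) by (auto simp: r_def s_def)
  qed
  show thesis
  proof (rule that[OF cb])
    show "infinite F"
    proof
      assume "finite F"
      then have "|F| \<le>o |D|"
        using D(3) by (rule ordLeq3_finite_infinite)
      then have "|c ` C \<union> F| \<le>o |D|"
        by (rule card_of_Un_bound[OF D(3) ordLeq_transitive[OF card_of_image C_card]])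
      moreover have "c ` C \<union> F = G"
        using c(2) by (auto simp: F_def)
      ultimately show False
        using not_ordLess_ordLeq[OF G(5)] by simp
    qed
    show "u (e k) = l *s e k + s k" if "k \<in> K" for k
      unfolding e_def u_eq[of "e0 (s k)"] using we0[OF s_D[OF that]] by (simp add: add.commute)
    show "u k \<in> span {j \<in> K. r j < r (s k)}" if k: "k \<in> K" for k
    proof (cases "k \<in> D")
      case True
      have "span {d' \<in> D. r0 d' < r0 (s0 k)} \<subseteq> span {j \<in> K. r j < r (s k)}"
        by (rule span_mono) (use True s0(1) in \<open>auto simp: K_def r_def s_def\<close>)
      then show ?thesis
        using s0(3) True by blast
    next
      case False
      then have "u k = l *s k"
        using k c(2) uG by (auto simp: K_def)
      moreover have "k \<in> span {j \<in> K. r j < r (s k)}"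
        by (rule span_base) (use k False s_D[OF k] in \<open>simp add: r_def\<close>)
      ultimately show ?thesis
        by (simp add: span_scale)
    qed
    show "u x = l *s x" if "x \<in> F" for x
      using that uG by (simp add: F_def)
  qed
qed

end

section \<open>From split polynomials to quadratic operators, and the theorem\<close>

lemma split_quadratic:
  fixes p :: "'f::field poly"
  assumes "splits p" "nonderogatory p" "degree p = 2"
  obtains a b h where "p = [:h * (a * b), - h * (a + b), h:]" "h \<noteq> 0" "a * b \<noteq> 0"
    "\<And>x. poly p x = 0 \<longleftrightarrow> x \<in> {a, b}" "poly_norm p = a * b"
proof -
  obtain A where A: "p = smult (lead_coeff p) (\<Prod>c\<in>#A. [:- c, 1:])"
    using assms(1) by (auto simp: splits_def)
  define h where "h = lead_coeff p"
  have h: "h \<noteq> 0"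
    unfolding h_def by (rule leading_coeff_neq_0) (use assms(3) in auto)
  \<comment> \<open>The degree counts the linear factors, so degree 2 leaves exactly two roots with
    multiplicity.\<close>
  have deg: "degree (\<Prod>c\<in>#A. [:- c, 1:]) = size A \<and> (\<Prod>c\<in>#A. [:- c, 1:]) \<noteq> 0" for A :: "'f multiset"
    by (induction A) (auto simp: degree_mult_eq simp del: mult_pCons_left)
  have "size A = 2"
    using arg_cong[OF A, of degree] assms(3) h deg[of A] by (simp add: h_def)
  then have "size A = Suc (Suc 0)"
    by simp
  then obtain a A' where "A = add_mset a A'" "size A' = Suc 0"
    using size_eq_Suc_imp_eq_union by fastforce
  moreover obtain b where "A' = {#b#}"
    using size_1_singleton_mset[of A'] calculation(2) by auto
  ultimately have ab: "A = {#a, b#}"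
    by simp
  have p: "p = smult h ([:- a, 1:] * [:- b, 1:])"
    using A by (simp add: ab h_def)
  then have p': "p = [:h * (a * b), - h * (a + b), h:]"
    by (simp add: algebra_simps)
  show thesis
  proof (rule that[OF p' h])
    show "a * b \<noteq> 0"
      using assms(2) h by (simp add: nonderogatory_def p)
    have "poly p x = h * ((x - a) * (x - b))" for x
      by (simp add: p' algebra_simps)
    then show "poly p x = 0 \<longleftrightarrow> x \<in> {a, b}" for x
      using h by simp
    show "poly_norm p = a * b"
      using h by (simp add: poly_norm_def monic_norm_def p')
  qed
qed

lemma (in endo_algebra) endo_poly_quadratic:
  assumes "p = [:h * (a * b), - h * (a + b), h:]" "h \<noteq> 0" "quadratic a b f"
  shows "endo_poly scale p f = (\<lambda>x. 0)"
proof
  fix x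
  have "degree p = 2" "coeff p 0 = h * (a * b)" "coeff p 1 = - h * (a + b)" "coeff p 2 = h"
    using assms(2) by (simp_all add: assms(1) numeral_2_eq_2)
  then have "endo_poly scale p f x = (h * (a * b)) *s x + (- h * (a + b)) *s f x + h *s f (f x)"
    by (simp add: endo_poly_def numeral_2_eq_2)
  also have "f (f x) = (a + b) *s f x - (a * b) *s x"
    using assms(3) by (simp add: quadratic_def)
  finally show "endo_poly scale p f x = 0"
    by (simp add: scale_right_diff_distrib)
qed

theorem theorem1p5:
  fixes scale :: "'f::field \<Rightarrow> 'v::ab_group_add \<Rightarrow> 'v"
    and p1 p2 p3 :: "'f poly"
    and u :: "'v \<Rightarrow> 'v"
    and c :: 'f
  assumes "vector_space scale"
    and "cinfinite (cdim scale UNIV)"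
    and "splits p1" "splits p2" "splits p3"
    and "nonderogatory p1" "nonderogatory p2" "nonderogatory p3"
    and "degree p1 = 2" "degree p2 = 2" "degree p3 = 2"
    and "automorphism scale u"
    and "dominant_eigenvalue scale u c"
    and "acceptable p1 p2 p3 c"
    and "cinfinite (rk scale (\<lambda>x. u x - scale c x))"
  shows "endo_product_of scale [p1, p2, p3] u"
proof -
  interpret endo_algebra scale
    using assms(1) by (simp add: endo_algebra_def)
  obtain a1 b1 h1 where p1: "p1 = [:h1 * (a1 * b1), - h1 * (a1 + b1), h1:]" "h1 \<noteq> 0" "a1 * b1 \<noteq> 0"
      "\<And>x. poly p1 x = 0 \<longleftrightarrow> x \<in> {a1, b1}" "poly_norm p1 = a1 * b1"
    by (rule split_quadratic[OF assms(3,6,9)]) (rule that)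
  obtain a2 b2 h2 where p2: "p2 = [:h2 * (a2 * b2), - h2 * (a2 + b2), h2:]" "h2 \<noteq> 0" "a2 * b2 \<noteq> 0"
      "\<And>x. poly p2 x = 0 \<longleftrightarrow> x \<in> {a2, b2}" "poly_norm p2 = a2 * b2"
    by (rule split_quadratic[OF assms(4,7,10)]) (rule that)
  obtain a3 b3 h3 where p3: "p3 = [:h3 * (a3 * b3), - h3 * (a3 + b3), h3:]" "h3 \<noteq> 0" "a3 * b3 \<noteq> 0"
      "\<And>x. poly p3 x = 0 \<longleftrightarrow> x \<in> {a3, b3}" "poly_norm p3 = a3 * b3"
    by (rule split_quadratic[OF assms(5,8,11)]) (rule that)
  have acc: "(\<exists>x1 x2 x3. x1 \<in> {a1, b1} \<and> x2 \<in> {a2, b2} \<and> x3 \<in> {a3, b3} \<and> c = x1 * x2 * x3) \<or>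
      c\<^sup>2 = (a1 * b1) * (a2 * b2) * (a3 * b3)"
    using assms(14) unfolding acceptable_def p1(5) p2(5) p3(5)
  proof
    assume "scalar_product_of [p1, p2, p3] c"
    then obtain x1 x2 x3 where "poly p1 x1 = 0" "poly p2 x2 = 0" "poly p3 x3 = 0" "c = prod_list [x1, x2, x3]"
      by (auto simp: scalar_product_of_def list_all2_Cons1)
    then have "x1 \<in> {a1, b1}" "x2 \<in> {a2, b2}" "x3 \<in> {a3, b3}" "c = x1 * x2 * x3"
      by (simp_all only: p1(4) p2(4) p3(4)) (simp add: mult.assoc)
    then show ?thesis by blast
  qed simp
  define w where "w = (\<lambda>x. u x - scale c x)"
  have u: "endo scale u" "bij u"
    using assms(12) by (auto simp: automorphism_def)
  have "endo scale w"
    by (simp add: w_def endo_iff endo_simps[OF u(1)] algebra_simps)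
  then have "module_hom scale scale w"
    by (simp add: endo_def module_hom_iff_linear)
  \<comment> \<open>The image is a subspace, so the basis supplied by the rank spans the image
    itself.\<close>
  then have span_w: "span (range w) = range w"
    using module_hom.subspace_image[OF _ subspace_UNIV] by simp
  obtain D where D: "independent D" "span D = span (range w)" "|D| =o rk scale w"
    using cdim_basis_exists[OF assms(1), of "range w"] unfolding rk_def by blast
  obtain U where U: "independent U" "span U = span UNIV" "|U| =o cdim scale UNIV"
    using cdim_basis_exists[OF assms(1), of UNIV] by blast
  have less: "rk scale w <o cdim scale UNIV"
    using assms(13) by (simp add: dominant_eigenvalue_def w_def)
  have DU: "|D| <o |U|"
    by (rule ordLess_ordIso_trans[OF ordIso_ordLess_trans[OF D(3) less] ordIso_symmetric[OF U(3)]])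
  have infD: "infinite D"
    using assms(15) cinfinite_mono[OF ordIso_imp_ordLeq[OF ordIso_symmetric[OF D(3)]]]
    by (simp add: w_def cinfinite_def Field_card_of)
  have spans: "span D = range (\<lambda>x. u x - scale c x)" "span U = UNIV"
    using U(2) D(2) span_w by (simp_all add: w_def)
  obtain K F s e r where "chain_basis scale K F s e r" and F: "infinite F"
      "\<And>k. k \<in> K \<Longrightarrow> u (e k) = scale c (e k) + s k"
      "\<And>k. k \<in> K \<Longrightarrow> u k \<in> span {j \<in> K. r j < r (s k)}" "\<And>x. x \<in> F \<Longrightarrow> u x = scale c x"
    by (rule chain_basis_ex[OF u(1) D(1) spans(1) infD U(1) spans(2) DU]) (rule that)
  then interpret chain_basis scale K F s e r
    by simp
  \<comment> \<open>For \<open>c = 0\<close> the map \<open>w\<close> would be the surjective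
    \<open>u\<close>, of rank equal to the dimension, against dominance.\<close>
  have "c \<noteq> 0"
  proof
    assume "c = 0"
    then have "range w = UNIV"
      using u(2) by (simp add: w_def bij_is_surj)
    then show False
      using less ordLess_irreflexive[of "cdim scale UNIV"] by (simp add: rk_def)
  qed
  obtain g1 g2 g3 where g: "quadratic a1 b1 g1" "quadratic a2 b2 g2" "quadratic a3 b3 g3"
      "\<And>x. u x = g1 (g2 (g3 x))"
    by (rule factorization[OF u _ _ _ F(1) \<open>c \<noteq> 0\<close> p1(3) p2(3) p3(3) acc])
      (erule F(2), erule F(3), erule F(4), rule that)
  have "endo scale g1" "endo scale g2" "endo scale g3"
    using g by (simp_all add: quadratic_def)
  then have "list_all2 (\<lambda>p a. endo scale a \<and> endo_poly scale p a = (\<lambda>x. 0)) [p1, p2, p3] [g1, g2, g3]"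
    using endo_poly_quadratic[OF p1(1,2) g(1)] endo_poly_quadratic[OF p2(1,2) g(2)]
      endo_poly_quadratic[OF p3(1,2) g(3)] by simp
  moreover have "u = foldr (\<circ>) [g1, g2, g3] id"
    by (rule ext) (simp add: g(4))
  ultimately show ?thesis
    unfolding endo_product_of_def by (intro exI[of _ "[g1, g2, g3]"] conjI)
qed

end
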